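(* Let $k$ be a field of characteristic $0$, let $b\in k\setminus k^{3}$, and let $K=k(\alpha)$ where $\alpha^3+b=0$. Let $g(t)=1+\sum_{i=1}^{6}c_{i}t^{i}\in k[t]$ and suppose that \[ (c_{2},c_{4},c_{5})\neq \left(\frac{5 c_1^2}{12},\;-\frac{1}{144} c_1(5 c_1^3-72 c_3),\;-\frac{1}{144} c_1^2(c_1^3-12c_3)\right). \] Then the variety $\mathcal{S}_{g}\subset\mathbb{A}^4$ defined by \[ X_{1}^3-bX_{2}^3+b^2X_{3}^3+3bX_{1}X_{2}X_{3}=g(t) \] is $k$-unirational.
   Context: The left-hand side is the norm form $N_{K/k}(X_1+\alpha X_2+\alpha^2X_3)$ of the pure cubic extension $K/k$. A variety over $k$ is $k$-unirational if there is a dominant rational map defined over $k$ from some affine space $\mathbb{A}^n_k$ to it. *)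

theory Defs
  imports
    "HOL-Library.Poly_Mapping"
    "HOL-Library.FuncSet"
    "HOL-Computational_Algebra.Polynomial"
    "HOL-Algebra.Algebraic_Closure_Type"
begin

text \<open>
  The ground field \<open>k\<close> is a type \<open>'a\<close> of class \<^class>\<open>field\<close>. Varieties over \<open>k\<close> are represented by
  their sets of geometric points, i.e. points over the algebraic closure \<^typ>\<open>'a alg_closure\<close>
  (so nothing depends on how many \<open>k\<close>-rational points there are).
\<close>

subsection \<open>Multivariate polynomials\<close>

text \<open>Exponent vectors map variable indices to exponents; polynomials map them to coefficients.\<close>

type_synonym 'a mpoly = "(nat \<Rightarrow>\<^sub>0 nat) \<Rightarrow>\<^sub>0 'a"

definition mpolys :: "nat \<Rightarrow> 'a::zero mpoly set" where
  "mpolys n = {p. \<forall>m \<in> Poly_Mapping.keys p. Poly_Mapping.keys m \<subseteq> {..<n}}"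

definition eval_mpoly :: "'a::comm_semiring_1 mpoly \<Rightarrow> (nat \<Rightarrow> 'a) \<Rightarrow> 'a" where
  "eval_mpoly p x = (\<Sum>m \<in> Poly_Mapping.keys p.
     Poly_Mapping.lookup p m * (\<Prod>i \<in> Poly_Mapping.keys m. x i ^ Poly_Mapping.lookup m i))"

definition eval_mpoly_ac :: "'a::field mpoly \<Rightarrow> (nat \<Rightarrow> 'a alg_closure) \<Rightarrow> 'a alg_closure" where
  "eval_mpoly_ac p x = eval_mpoly (Poly_Mapping.map to_ac p) x"

subsection \<open>Affine space and its Zariski topology\<close>

definition affine_space :: "nat \<Rightarrow> (nat \<Rightarrow> 'b) set" where
  "affine_space n = {..<n} \<rightarrow>\<^sub>E UNIV"

definition zariski_closed :: "nat \<Rightarrow> (nat \<Rightarrow> 'b::field) set \<Rightarrow> bool" where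
  "zariski_closed n Z \<longleftrightarrow>
     (\<exists>I \<subseteq> mpolys n. Z = {x \<in> affine_space n. \<forall>p \<in> I. eval_mpoly p x = 0})"

definition zariski_dense_in :: "nat \<Rightarrow> (nat \<Rightarrow> 'b::field) set \<Rightarrow> (nat \<Rightarrow> 'b) set \<Rightarrow> bool" where
  "zariski_dense_in n S V \<longleftrightarrow> S \<subseteq> V \<and> (\<forall>Z. zariski_closed n Z \<and> S \<subseteq> Z \<longrightarrow> V \<subseteq> Z)"

subsection \<open>Rational maps between affine spaces and unirationality\<close>

text \<open>
  A rational map from \<open>n\<close>-space to \<open>m\<close>-space over \<open>k\<close> is given by \<open>m\<close> fractions \<open>P i / Q i\<close> of
  polynomials over \<open>k\<close> in \<open>n\<close> variables. It is regular on the nonempty open set where all \<open>Q i\<close> are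
  nonzero; neither landing in a closed set nor having dense image depends on the choice of the
  nonempty open set on which the map is evaluated.
\<close>

definition rational_map_data :: "nat \<Rightarrow> nat \<Rightarrow> (nat \<Rightarrow> 'a::zero mpoly) \<Rightarrow> (nat \<Rightarrow> 'a mpoly) \<Rightarrow> bool" where
  "rational_map_data n m P Q \<longleftrightarrow> (\<forall>i<m. P i \<in> mpolys n \<and> Q i \<in> mpolys n \<and> Q i \<noteq> 0)"

definition rational_map_domain ::
    "nat \<Rightarrow> nat \<Rightarrow> (nat \<Rightarrow> 'a::field mpoly) \<Rightarrow> (nat \<Rightarrow> 'a alg_closure) set" where
  "rational_map_domain n m Q = {x \<in> affine_space n. \<forall>i<m. eval_mpoly_ac (Q i) x \<noteq> 0}"

definition rational_map ::
    "nat \<Rightarrow> (nat \<Rightarrow> 'a::field mpoly) \<Rightarrow> (nat \<Rightarrow> 'a mpoly) \<Rightarrow>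
     (nat \<Rightarrow> 'a alg_closure) \<Rightarrow> (nat \<Rightarrow> 'a alg_closure)" where
  "rational_map m P Q x = (\<lambda>i \<in> {..<m}. eval_mpoly_ac (P i) x / eval_mpoly_ac (Q i) x)"

definition dominant_rational_map ::
    "nat \<Rightarrow> nat \<Rightarrow> (nat \<Rightarrow> 'a::field mpoly) \<Rightarrow> (nat \<Rightarrow> 'a mpoly) \<Rightarrow>
     (nat \<Rightarrow> 'a alg_closure) set \<Rightarrow> bool" where
  "dominant_rational_map n m P Q V \<longleftrightarrow>
     rational_map_data n m P Q \<and>
     zariski_dense_in m (rational_map m P Q ` rational_map_domain n m Q) V"

text \<open>Here \<open>V\<close> is a closed subvariety of affine \<open>m\<close>-space, and \<open>k\<close> is read off from the type \<open>'a\<close>.\<close>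

definition k_unirational :: "nat \<Rightarrow> (nat \<Rightarrow> 'a::field alg_closure) set \<Rightarrow> bool" where
  "k_unirational m V \<longleftrightarrow> (\<exists>n P Q. dominant_rational_map n m P Q V)"

subsection \<open>The field extension and the variety\<close>

text \<open>The subfield \<open>k(\<alpha>)\<close> of the algebraic closure.\<close>

inductive_set field_adjoin :: "'a::field alg_closure \<Rightarrow> 'a alg_closure set"
  for \<alpha> :: "'a alg_closure" where
  base: "to_ac x \<in> field_adjoin \<alpha>"
| gen: "\<alpha> \<in> field_adjoin \<alpha>"
| diff: "u \<in> field_adjoin \<alpha> \<Longrightarrow> v \<in> field_adjoin \<alpha> \<Longrightarrow> u - v \<in> field_adjoin \<alpha>"
| mult: "u \<in> field_adjoin \<alpha> \<Longrightarrow> v \<in> field_adjoin \<alpha> \<Longrightarrow> u * v \<in> field_adjoin \<alpha>"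
| inverse: "u \<in> field_adjoin \<alpha> \<Longrightarrow> inverse u \<in> field_adjoin \<alpha>"

text \<open>
  The coordinates \<open>(X\<^sub>1, X\<^sub>2, X\<^sub>3, t)\<close> of affine 4-space are \<open>(x 0, x 1, x 2, x 3)\<close>. The left-hand side
  is the norm form of \<open>X\<^sub>1 + \<alpha> X\<^sub>2 + \<alpha>\<^sup>2 X\<^sub>3\<close> for \<open>\<alpha>\<^sup>3 = -b\<close>.
\<close>

definition norm_variety :: "'a::field \<Rightarrow> 'a poly \<Rightarrow> (nat \<Rightarrow> 'a alg_closure) set" where
  "norm_variety b g = {x \<in> affine_space 4.
     x 0 ^ 3 - to_ac b * x 1 ^ 3 + to_ac b ^ 2 * x 2 ^ 3 + 3 * to_ac b * x 0 * x 1 * x 2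
       = poly (map_poly to_ac g) (x 3)}"

end

theory Submission
  imports Defs
begin

text \<open>
  Look for points \<open>(1 + p T + P T\<^sup>2, u T + q T\<^sup>2, r T\<^sup>2)\<close> with \<open>t = T\<close>, where \<open>u\<close> is a free parameter. The
  coefficients of \<open>T\<close>, ..., \<open>T\<^sup>4\<close> in the equation can be matched one after the other by linear equations,
  and what remains is \<open>T\<^sup>5 (A\<^sub>5 + A\<^sub>6 T) = 0\<close>, so \<open>T = - A\<^sub>5 / A\<^sub>6\<close> is a rational function of \<open>u\<close>. It tends to \<open>0\<close> as \<open>u\<close>
  grows, and \<open>A\<^sub>5\<close> vanishes identically precisely for the excluded triple \<open>(c\<^sub>2, c\<^sub>4, c\<^sub>5)\<close>; hence \<open>T\<close> is not
  constant. The fibre of the variety over \<open>t = T(u)\<close> is thus a torsor, with a rational point, under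
  the norm one torus, which is covered by \<open>W \<mapsto> W\<^sup>3 / N(W)\<close>.
\<close>

subsection \<open>Polynomial functions\<close>

definition monomial_value :: "(nat \<Rightarrow>\<^sub>0 nat) \<Rightarrow> (nat \<Rightarrow> 'b::comm_semiring_1) \<Rightarrow> 'b" where
  "monomial_value m x = (\<Prod>i \<in> Poly_Mapping.keys m. x i ^ Poly_Mapping.lookup m i)"

lemma monomial_value_superset:
  assumes "finite A" "Poly_Mapping.keys m \<subseteq> A"
  shows "monomial_value m x = (\<Prod>i\<in>A. x i ^ Poly_Mapping.lookup m i)"
  unfolding monomial_value_def
  by (rule prod.mono_neutral_left) (use assms in \<open>auto simp: in_keys_iff\<close>)

lemma monomial_value_add: "monomial_value (m + m') x = monomial_value m x * monomial_value m' x"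
proof -
  let ?A = "Poly_Mapping.keys m \<union> Poly_Mapping.keys m'"
  have "monomial_value (m + m') x = (\<Prod>i\<in>?A. x i ^ Poly_Mapping.lookup (m + m') i)"
    by (rule monomial_value_superset) (auto simp: keys_add)
  also have "\<dots> = (\<Prod>i\<in>?A. x i ^ Poly_Mapping.lookup m i) * (\<Prod>i\<in>?A. x i ^ Poly_Mapping.lookup m' i)"
    by (simp add: lookup_add power_add prod.distrib)
  also have "\<dots> = monomial_value m x * monomial_value m' x"
    by (simp add: monomial_value_superset[of ?A])
  finally show ?thesis .
qed

lemma eval_mpoly_ac_eq:
  "eval_mpoly_ac p x =
     (\<Sum>m\<in>Poly_Mapping.keys p. to_ac (Poly_Mapping.lookup p m) * monomial_value m x)"
proof -
  \<comment> \<open>\<open>to_ac\<close> sends only 0 to 0, so the change of coefficient field loses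
    no key.\<close>
  have "Poly_Mapping.keys (Poly_Mapping.map to_ac p) = Poly_Mapping.keys p"
    by (auto simp: in_keys_iff Poly_Mapping.map.rep_eq when_def split: if_splits)
  thus ?thesis
    by (auto simp: eval_mpoly_ac_def eval_mpoly_def monomial_value_def Poly_Mapping.map.rep_eq
        when_def in_keys_iff intro!: sum.cong)
qed

lemma eval_mpoly_ac_0 [simp]: "eval_mpoly_ac 0 x = 0"
  by (simp add: eval_mpoly_ac_eq)

lemma eval_mpoly_ac_single [simp]:
  "eval_mpoly_ac (Poly_Mapping.single m a) x = to_ac a * monomial_value m x"
  by (simp add: eval_mpoly_ac_eq)

lemma eval_mpoly_ac_add [simp]:
  "eval_mpoly_ac (p + q) x = eval_mpoly_ac p x + eval_mpoly_ac q x"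
  unfolding eval_mpoly_ac_eq
  by (rule setsum_keys_plus_distrib) (auto simp: algebra_simps)

lemma eval_mpoly_ac_sum [simp]:
  "eval_mpoly_ac (\<Sum>i\<in>A. f i) x = (\<Sum>i\<in>A. eval_mpoly_ac (f i) x)"
  by (induction A rule: infinite_finite_induct) auto

lemma poly_mapping_sum_single:
  "(\<Sum>m\<in>Poly_Mapping.keys p. Poly_Mapping.single m (Poly_Mapping.lookup p m)) = p"
  by (rule poly_mapping_eqI)
     (auto simp: lookup_sum lookup_single when_def in_keys_iff sum.delta')

lemma eval_mpoly_ac_mult [simp]:
  "eval_mpoly_ac (p * q) x = eval_mpoly_ac p x * eval_mpoly_ac q x"
proof -
  let ?s = "\<lambda>p m. Poly_Mapping.single m (Poly_Mapping.lookup p m)"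
  have "p * q = (\<Sum>m\<in>Poly_Mapping.keys p. ?s p m) * (\<Sum>m\<in>Poly_Mapping.keys q. ?s q m)"
    by (simp add: poly_mapping_sum_single)
  also have "eval_mpoly_ac \<dots> x = eval_mpoly_ac p x * eval_mpoly_ac q x"
    by (simp add: sum_product mult_single monomial_value_add eval_mpoly_ac_eq[of p]
        eval_mpoly_ac_eq[of q] mult_ac)
  finally show ?thesis .
qed

text \<open>Working with functions and closure rules avoids writing exponent vectors. The
  coefficients are required to lie in k, so this predicate carries the rationality over k of the
  final map.\<close>

definition polyfun :: "nat \<Rightarrow> ((nat \<Rightarrow> 'a::field alg_closure) \<Rightarrow> 'a alg_closure) \<Rightarrow> bool" where
  "polyfun n f \<longleftrightarrow> (\<exists>p\<in>mpolys n. eval_mpoly_ac p = f)"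

named_theorems polyfun_intros

lemma polyfun_const [polyfun_intros]: "polyfun n (\<lambda>x. to_ac a)"
  unfolding polyfun_def
  by (rule bexI[of _ "Poly_Mapping.single 0 a"]) (auto simp: mpolys_def monomial_value_def)

lemma polyfun_numeral [polyfun_intros]: "polyfun n (\<lambda>x. numeral k)"
  using polyfun_const[of n "numeral k"] by simp

lemma polyfun_1 [polyfun_intros]: "polyfun n (\<lambda>x. 1)"
  using polyfun_const[of n 1] by simp

lemma polyfun_var [polyfun_intros]: "i < n \<Longrightarrow> polyfun n (\<lambda>x. x i)"
  unfolding polyfun_def
  by (rule bexI[of _ "Poly_Mapping.single (Poly_Mapping.single i 1) 1"])
     (auto simp: mpolys_def monomial_value_def)

lemma polyfun_add [polyfun_intros]:
  assumes "polyfun n f" "polyfun n g"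
  shows "polyfun n (\<lambda>x. f x + g x)"
proof -
  from assms obtain p q where "p \<in> mpolys n" "q \<in> mpolys n" "f = eval_mpoly_ac p" "g = eval_mpoly_ac q"
    unfolding polyfun_def by auto
  thus ?thesis unfolding polyfun_def
    by (intro bexI[of _ "p + q"]) (auto simp: mpolys_def dest!: subsetD[OF keys_add])
qed

lemma polyfun_mult [polyfun_intros]:
  assumes "polyfun n f" "polyfun n g"
  shows "polyfun n (\<lambda>x. f x * g x)"
proof -
  from assms obtain p q where "p \<in> mpolys n" "q \<in> mpolys n" "f = eval_mpoly_ac p" "g = eval_mpoly_ac q"
    unfolding polyfun_def by auto
  moreover have "p * q \<in> mpolys n" unfolding mpolys_def
  proof safe
    fix m i assume "m \<in> Poly_Mapping.keys (p * q)" "i \<in> Poly_Mapping.keys m"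
    then obtain a b where "a \<in> Poly_Mapping.keys p" "b \<in> Poly_Mapping.keys q" "i \<in> Poly_Mapping.keys (a + b)"
      using keys_mult[of p q] by auto
    thus "i < n" using calculation(1,2) subsetD[OF keys_add, of i a b] unfolding mpolys_def by blast
  qed
  ultimately show ?thesis unfolding polyfun_def by (intro bexI[of _ "p * q"]) auto
qed

lemma polyfun_minus [polyfun_intros]: "polyfun n f \<Longrightarrow> polyfun n (\<lambda>x. - f x)"
  using polyfun_mult[OF polyfun_const[of n "-1"], of f] by simp

lemma polyfun_diff [polyfun_intros]: "polyfun n f \<Longrightarrow> polyfun n g \<Longrightarrow> polyfun n (\<lambda>x. f x - g x)"
  using polyfun_add[OF _ polyfun_minus, of n f g] by simp

lemma polyfun_power [polyfun_intros]: "polyfun n f \<Longrightarrow> polyfun n (\<lambda>x. f x ^ k)"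
  by (induction k) (auto intro: polyfun_intros)

text \<open>One common denominator \<open>h\<close> serves all coordinates;
  \<open>h x0 \<noteq> 0\<close> makes the polynomial behind it nonzero. Positivity of
  \<open>m\<close> ensures that the domain tests \<open>h\<close> at all.\<close>

lemma k_unirationalI:
  fixes V :: "(nat \<Rightarrow> 'a::field alg_closure) set"
  assumes f: "\<And>i. i < m \<Longrightarrow> polyfun n (f i)" and h: "polyfun n h"
    and nz: "h x0 \<noteq> 0"
    and dense: "zariski_dense_in m
      ((\<lambda>x. \<lambda>i\<in>{..<m}. f i x / h x) ` {x \<in> affine_space n. h x \<noteq> 0}) V"
    and "m > 0"
  shows "k_unirational m V"
proof -
  have "\<forall>i\<in>{..<m}. \<exists>p. p \<in> mpolys n \<and> eval_mpoly_ac p = f i"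
    using f by (auto simp: polyfun_def)
  then obtain P where P: "\<And>i. i < m \<Longrightarrow> P i \<in> mpolys n \<and> eval_mpoly_ac (P i) = f i"
    by (metis lessThan_iff)
  obtain q where q: "q \<in> mpolys n" "eval_mpoly_ac q = h"
    using h by (auto simp: polyfun_def)
  have "q \<noteq> 0" using nz q(2) by auto
  have "rational_map_domain n m (\<lambda>_. q) = {x \<in> affine_space n. h x \<noteq> 0}"
    using q \<open>m > 0\<close> by (auto simp: rational_map_domain_def)
  moreover have "rational_map m P (\<lambda>_. q) = (\<lambda>x. \<lambda>i\<in>{..<m}. f i x / h x)"
    using P q by (auto simp: rational_map_def fun_eq_iff)
  ultimately have "dominant_rational_map n m P (\<lambda>_. q) V"
    using P q \<open>q \<noteq> 0\<close> dense by (simp add: dominant_rational_map_def rational_map_data_def)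
  thus ?thesis unfolding k_unirational_def by blast
qed

section \<open>Polynomial curves and Zariski closed sets\<close>

lemma eval_mpoly_along_curve:
  fixes C :: "nat \<Rightarrow> 'b::field poly"
  obtains R where "\<And>s. poly R s = eval_mpoly p (\<lambda>i. poly (C i) s)"
proof
  show "poly (\<Sum>m\<in>Poly_Mapping.keys p. [:Poly_Mapping.lookup p m:] *
      (\<Prod>i\<in>Poly_Mapping.keys m. C i ^ Poly_Mapping.lookup m i)) s =
    eval_mpoly p (\<lambda>i. poly (C i) s)" for s
    by (simp add: eval_mpoly_def poly_sum poly_prod)
qed

lemma eval_mpoly_cong:
  assumes "p \<in> mpolys n" "\<And>i. i < n \<Longrightarrow> x i = y i"
  shows "eval_mpoly p x = eval_mpoly p y"
  using assms unfolding eval_mpoly_def mpolys_def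
  by (intro sum.cong prod.cong arg_cong2[of _ _ _ _ "(*)"]) (auto simp: subset_iff)

text \<open>Each defining equation, restricted to the curve, is a polynomial in \<open>s\<close>
  with infinitely many roots, hence zero.\<close>

lemma in_zariski_closed_curve:
  fixes C :: "nat \<Rightarrow> 'b::field poly"
  assumes Z: "zariski_closed n Z" and inf: "infinite {s. (\<lambda>i\<in>{..<n}. poly (C i) s) \<in> Z}"
  shows "(\<lambda>i\<in>{..<n}. poly (C i) s0) \<in> Z"
proof -
  obtain I where I: "I \<subseteq> mpolys n" "Z = {x \<in> affine_space n. \<forall>p \<in> I. eval_mpoly p x = 0}"
    using Z by (auto simp: zariski_closed_def)
  have "eval_mpoly p (\<lambda>i\<in>{..<n}. poly (C i) s0) = 0" if "p \<in> I" for p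
  proof -
    have p: "p \<in> mpolys n" using I that by auto
    obtain R where R: "\<And>s. poly R s = eval_mpoly p (\<lambda>i. poly (C i) s)"
      using eval_mpoly_along_curve by blast
    have R': "poly R s = eval_mpoly p (\<lambda>i\<in>{..<n}. poly (C i) s)" for s
      unfolding R by (rule eval_mpoly_cong[OF p]) auto
    have "{s. (\<lambda>i\<in>{..<n}. poly (C i) s) \<in> Z} \<subseteq> {s. poly R s = 0}"
      using I that R' by auto
    hence "infinite {s. poly R s = 0}" using inf finite_subset by blast
    hence "R = 0" using poly_roots_finite by blast
    thus ?thesis using R'[of s0] by simp
  qed
  thus ?thesis using I by (auto simp: affine_space_def)
qed

subsection \<open>The norm form\<close>

definition norm3 :: "'b::comm_ring_1 \<Rightarrow> 'b \<times> 'b \<times> 'b \<Rightarrow> 'b" where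
  "norm3 b = (\<lambda>(x, y, z). x ^ 3 - b * y ^ 3 + b ^ 2 * z ^ 3 + 3 * b * x * y * z)"

text \<open>Multiplication of \<open>x + \<alpha> y + \<alpha>\<^sup>2 z\<close>, where \<open>\<alpha>\<^sup>3 = - b\<close>.\<close>

definition mult3 :: "'b::comm_ring_1 \<Rightarrow> 'b \<times> 'b \<times> 'b \<Rightarrow> 'b \<times> 'b \<times> 'b \<Rightarrow> 'b \<times> 'b \<times> 'b" where
  "mult3 b = (\<lambda>(x, y, z) (x', y', z').
     (x * x' - b * (y * z' + z * y'), x * y' + y * x' - b * (z * z'), x * z' + y * y' + z * x'))"

definition cube3 :: "'b::comm_ring_1 \<Rightarrow> 'b \<times> 'b \<times> 'b \<Rightarrow> 'b \<times> 'b \<times> 'b" where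
  "cube3 b W = mult3 b W (mult3 b W W)"

definition scale3 :: "'b::comm_ring_1 \<Rightarrow> 'b \<times> 'b \<times> 'b \<Rightarrow> 'b \<times> 'b \<times> 'b" where
  "scale3 s = (\<lambda>(x, y, z). (s * x, s * y, s * z))"

text \<open>For \<open>\<beta> ^ 3 = - b\<close> this is the ring homomorphism that sends the
  generator of the cubic algebra to \<open>\<beta>\<close>. The three cube roots give the conjugate
  embeddings.\<close>

definition eval3 :: "'b::comm_ring_1 \<Rightarrow> 'b \<times> 'b \<times> 'b \<Rightarrow> 'b" where
  "eval3 \<beta> = (\<lambda>(x, y, z). x + \<beta> * y + \<beta> ^ 2 * z)"

lemma norm3_mult: "norm3 b (mult3 b A B) = norm3 b A * norm3 b B"
  by (cases A; cases B)
     (simp add: norm3_def mult3_def power2_eq_square power3_eq_cube algebra_simps)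

lemma norm3_cube: "norm3 b (cube3 b W) = norm3 b W ^ 3"
  by (simp add: cube3_def norm3_mult power3_eq_cube mult.assoc)

lemma norm3_scale: "norm3 b (scale3 s A) = s ^ 3 * norm3 b A"
  by (cases A) (simp add: norm3_def scale3_def power2_eq_square power3_eq_cube algebra_simps)

lemma mult3_scale: "mult3 b (scale3 s A) B = scale3 s (mult3 b A B)"
  by (cases A; cases B) (simp add: mult3_def scale3_def algebra_simps)

lemma scale3_scale: "scale3 s (scale3 t A) = scale3 (s * t) A"
  by (cases A) (simp add: scale3_def mult.assoc)

lemma eval3_mult:
  assumes "\<beta> ^ 3 = - b"
  shows "eval3 \<beta> (mult3 b A B) = eval3 \<beta> A * eval3 \<beta> B"
proof -
  have "b = - (\<beta> ^ 3)" using assms by simp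
  thus ?thesis
    by (cases A; cases B)
       (simp add: eval3_def mult3_def power2_eq_square power3_eq_cube algebra_simps)
qed

lemma eval3_cube: "\<beta> ^ 3 = - b \<Longrightarrow> eval3 \<beta> (cube3 b W) = eval3 \<beta> W ^ 3"
  by (simp add: cube3_def eval3_mult power3_eq_cube mult.assoc)

section \<open>Splitting of the norm form into three linear factors\<close>

locale split_cubic =
  fixes b \<alpha> \<omega> :: "'b::field_char_0"
  assumes alpha: "\<alpha> ^ 3 = - b" and omega: "\<omega> ^ 2 + \<omega> + 1 = 0" and b_nonzero: "b \<noteq> 0"
begin

lemma alpha_nonzero: "\<alpha> \<noteq> 0"
  using alpha b_nonzero by auto

lemma omega_sq: "\<omega> * \<omega> = - \<omega> - 1"
  using omega by (simp add: power2_eq_square algebra_simps eq_neg_iff_add_eq_0)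

lemma omega_cube: "\<omega> ^ 3 = 1"
  by (simp add: power3_eq_cube omega_sq algebra_simps)

lemma conjugates_cube: "(\<omega> * \<alpha>) ^ 3 = - b" "(\<omega> ^ 2 * \<alpha>) ^ 3 = - b"
proof -
  have "(\<omega> ^ 2) ^ 3 = 1" by (metis omega_cube power_mult mult.commute power_one)
  thus "(\<omega> * \<alpha>) ^ 3 = - b" "(\<omega> ^ 2 * \<alpha>) ^ 3 = - b"
    by (simp_all only: power_mult_distrib alpha omega_cube) simp_all
qed

lemma eval3_conjugates:
  "eval3 \<alpha> (x, y, z) = x + \<alpha> * y + \<alpha> ^ 2 * z"
  "eval3 (\<omega> * \<alpha>) (x, y, z) = x + \<omega> * (\<alpha> * y) - (\<omega> + 1) * (\<alpha> ^ 2 * z)"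
  "eval3 (\<omega> ^ 2 * \<alpha>) (x, y, z) = x - (\<omega> + 1) * (\<alpha> * y) + \<omega> * (\<alpha> ^ 2 * z)"
proof -
  have "\<omega> ^ 2 = - (\<omega> + 1)" by (simp add: power2_eq_square omega_sq)
  moreover have "(\<omega> ^ 2) ^ 2 = \<omega>"
    using omega_cube by (simp add: power2_eq_square power3_eq_cube mult.assoc)
  ultimately show "eval3 \<alpha> (x, y, z) = x + \<alpha> * y + \<alpha> ^ 2 * z"
    "eval3 (\<omega> * \<alpha>) (x, y, z) = x + \<omega> * (\<alpha> * y) - (\<omega> + 1) * (\<alpha> ^ 2 * z)"
    "eval3 (\<omega> ^ 2 * \<alpha>) (x, y, z) = x - (\<omega> + 1) * (\<alpha> * y) + \<omega> * (\<alpha> ^ 2 * z)"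
    unfolding eval3_def prod.case by (simp_all only: power_mult_distrib) (simp_all add: algebra_simps)
qed

lemma norm3_eq: "norm3 b A = eval3 \<alpha> A * eval3 (\<omega> * \<alpha>) A * eval3 (\<omega> ^ 2 * \<alpha>) A"
proof -
  obtain x y z where A: "A = (x, y, z)" by (cases A)
  \<comment> \<open>The classical factorization of x^3 + u^3 + v^3 - 3xuv, applied below with u =
    \<open>\<alpha> * y\<close> and v = \<open>\<alpha> ^ 2 * z\<close>; \<open>\<omega> ^ 2\<close>
    is written as \<open>- (\<omega> + 1)\<close>.\<close>
  have *: "(x + u + v) * (x + \<omega> * u - (\<omega> + 1) * v) * (x - (\<omega> + 1) * u + \<omega> * v) =
      x ^ 3 + u ^ 3 + v ^ 3 - 3 * x * u * v" for u v
    using omega_sq by Groebner_Basis.algebra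
  have "norm3 b A = x ^ 3 + (\<alpha> * y) ^ 3 + (\<alpha> ^ 2 * z) ^ 3 - 3 * x * (\<alpha> * y) * (\<alpha> ^ 2 * z)"
    using alpha unfolding A norm3_def prod.case by Groebner_Basis.algebra
  thus ?thesis unfolding A eval3_conjugates * .
qed

text \<open>The inverse discrete Fourier transform of order 3: it inverts the Vandermonde system of
  the three conjugates, so that in the coordinates \<open>r\<close>, \<open>s\<close>,
  \<open>t\<close> the norm becomes a product.\<close>

definition uneval3 :: "'b \<Rightarrow> 'b \<Rightarrow> 'b \<Rightarrow> 'b \<times> 'b \<times> 'b" where
  "uneval3 r s t = ((r + s + t) / 3, (r - (\<omega> + 1) * s + \<omega> * t) / (3 * \<alpha>),
     (r + \<omega> * s - (\<omega> + 1) * t) / (3 * \<alpha> ^ 2))"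

lemma eval3_uneval3:
  "eval3 \<alpha> (uneval3 r s t) = r"
  "eval3 (\<omega> * \<alpha>) (uneval3 r s t) = s"
  "eval3 (\<omega> ^ 2 * \<alpha>) (uneval3 r s t) = t"
proof -
  let ?u = "(r - (\<omega> + 1) * s + \<omega> * t) / 3" and ?v = "(r + \<omega> * s - (\<omega> + 1) * t) / 3"
  have u: "\<alpha> * ((r - (\<omega> + 1) * s + \<omega> * t) / (3 * \<alpha>)) = ?u"
    and v: "\<alpha> ^ 2 * ((r + \<omega> * s - (\<omega> + 1) * t) / (3 * \<alpha> ^ 2)) = ?v"
    using alpha_nonzero by simp_all
  show "eval3 \<alpha> (uneval3 r s t) = r"
    unfolding uneval3_def eval3_conjugates u v by (simp add: field_simps)
  have *: "\<omega> * (3 * ?u) = \<omega> * r + s - (\<omega> + 1) * t" "(\<omega> + 1) * (3 * ?u) = (\<omega> + 1) * r - \<omega> * s - t"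
    "\<omega> * (3 * ?v) = \<omega> * r - (\<omega> + 1) * s + t" "(\<omega> + 1) * (3 * ?v) = (\<omega> + 1) * r - s - \<omega> * t"
    using omega_sq by (simp_all only: times_divide_eq_right nonzero_mult_div_cancel_left zero_neq_numeral not_False_eq_True) Groebner_Basis.algebra+
  have "3 * eval3 (\<omega> * \<alpha>) (uneval3 r s t) = r + s + t + \<omega> * (3 * ?u) - (\<omega> + 1) * (3 * ?v)"
    unfolding uneval3_def eval3_conjugates u v by (simp add: algebra_simps)
  also have "\<dots> = 3 * s" unfolding * by (simp add: algebra_simps)
  finally show "eval3 (\<omega> * \<alpha>) (uneval3 r s t) = s" by simp
  have "3 * eval3 (\<omega> ^ 2 * \<alpha>) (uneval3 r s t) = r + s + t - (\<omega> + 1) * (3 * ?u) + \<omega> * (3 * ?v)"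
    unfolding uneval3_def eval3_conjugates u v by (simp add: algebra_simps)
  also have "\<dots> = 3 * t" unfolding * by (simp add: algebra_simps)
  finally show "eval3 (\<omega> ^ 2 * \<alpha>) (uneval3 r s t) = t" by simp
qed

lemma uneval3_eval3: "uneval3 (eval3 \<alpha> A) (eval3 (\<omega> * \<alpha>) A) (eval3 (\<omega> ^ 2 * \<alpha>) A) = A"
proof -
  obtain x y z where A: "A = (x, y, z)" by (cases A)
  let ?r = "eval3 \<alpha> A" and ?s = "eval3 (\<omega> * \<alpha>) A" and ?t = "eval3 (\<omega> ^ 2 * \<alpha>) A"
  have "?r + ?s + ?t = 3 * x"
    unfolding A eval3_conjugates by (simp add: algebra_simps)
  moreover have "?r - (\<omega> + 1) * ?s + \<omega> * ?t = 3 * (\<alpha> * y)"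
    using omega_sq unfolding A eval3_conjugates by Groebner_Basis.algebra
  moreover have "?r + \<omega> * ?s - (\<omega> + 1) * ?t = 3 * (\<alpha> ^ 2 * z)"
    using omega_sq unfolding A eval3_conjugates by Groebner_Basis.algebra
  ultimately show ?thesis
    using alpha_nonzero unfolding uneval3_def by (simp add: A)
qed

lemma norm3_uneval3: "norm3 b (uneval3 r s t) = r * s * t"
  by (simp add: norm3_eq eval3_uneval3)

end

lemma split_cubic_exists:
  fixes b :: "'b::{alg_closed_field, field_char_0}"
  assumes "b \<noteq> 0"
  obtains \<alpha> \<omega> where "split_cubic b \<alpha> \<omega>"
proof -
  obtain \<alpha> where "\<alpha> ^ 3 = - b" using nth_root_exists[of 3 "- b"] by auto
  moreover obtain \<omega> :: 'b where "poly [:1, 1, 1:] \<omega> = 0"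
    using alg_closed_imp_poly_has_root[of "[:1, 1, 1:] :: 'b poly"] by auto
  ultimately show ?thesis using assms
    by (intro that[of \<alpha> \<omega>]) (unfold_locales, auto simp: algebra_simps power2_eq_square)
qed

text \<open>Over an algebraically closed field \<open>W \<mapsto> W\<^sup>3 / N(W)\<close> maps onto the norm one torus, and \<open>W\<close> can
  even be chosen of norm one.\<close>

lemma norm3_fibre:
  fixes b :: "'b::{alg_closed_field, field_char_0}"
  assumes "b \<noteq> 0" "norm3 b A = norm3 b B" "norm3 b A \<noteq> 0"
  obtains W where "norm3 b W = 1" "mult3 b A (cube3 b W) = B"
proof -
  obtain \<alpha> \<omega> where "split_cubic b \<alpha> \<omega>" using split_cubic_exists assms(1) by blast
  then interpret split_cubic b \<alpha> \<omega> .
  let ?e = "eval3 \<alpha>" and ?f = "eval3 (\<omega> * \<alpha>)" and ?g = "eval3 (\<omega> ^ 2 * \<alpha>)"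
  have nz: "?e A \<noteq> 0" "?f A \<noteq> 0" "?g A \<noteq> 0" "?e B \<noteq> 0" "?f B \<noteq> 0" "?g B \<noteq> 0"
    using assms(2,3) by (auto simp: norm3_eq)
  obtain r where r: "r ^ 3 = ?e B / ?e A" using nth_root_exists[of 3] by auto
  obtain s where s: "s ^ 3 = ?f B / ?f A" using nth_root_exists[of 3] by auto
  have "r \<noteq> 0" "s \<noteq> 0" using r s nz by (auto simp: zero_power)
  \<comment> \<open>Norm one forces the third coordinate. Equality of the norms of \<open>A\<close>
    and \<open>B\<close> makes the three quotients multiply to 1, so its cube is the third
    quotient.\<close>
  have t: "(1 / (r * s)) ^ 3 = ?g B / ?g A"
    using assms(2) nz by (simp add: norm3_eq power_mult_distrib power_divide r s field_simps)
  define W where "W = uneval3 r s (1 / (r * s))"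
  have "norm3 b W = 1"
    using \<open>r \<noteq> 0\<close> \<open>s \<noteq> 0\<close> by (simp add: W_def norm3_uneval3)
  moreover have "mult3 b A (cube3 b W) = B"
  proof -
    have "?e (mult3 b A (cube3 b W)) = ?e B" "?f (mult3 b A (cube3 b W)) = ?f B"
      "?g (mult3 b A (cube3 b W)) = ?g B"
      using nz by (simp_all add: W_def eval3_mult eval3_cube alpha conjugates_cube eval3_uneval3 r s t)
    thus ?thesis by (metis uneval3_eval3)
  qed
  ultimately show ?thesis by (rule that)
qed

subsection \<open>Curves through the points of the norm variety\<close>

text \<open>The two nonzero coordinates stay constant and the third one absorbs \<open>G\<close>,
  with parameter s = t - t0.\<close>

lemma product_curve_nonzero:
  fixes G :: "'b::field poly"
  assumes "poly G t0 = e0 * e1 * e2" "e0 \<noteq> 0" "e1 \<noteq> 0"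
  shows "\<exists>m E0 E1 E2. m > 0 \<and> poly E0 0 = e0 \<and> poly E1 0 = e1 \<and> poly E2 0 = e2 \<and>
           (\<forall>s. poly E0 s * poly E1 s * poly E2 s = poly G (t0 + s ^ m))"
  by (rule exI[of _ 1], rule exI[of _ "[:e0:]"], rule exI[of _ "[:e1:]"],
      rule exI[of _ "smult (1 / (e0 * e1)) (pcompose G [:t0, 1:])"])
     (use assms in \<open>auto simp: poly_pcompose\<close>)

lemma product_curve_zero:
  fixes G :: "'b::field poly"
  assumes "poly G t0 = 0"
  shows "\<exists>m E0 E1 E2. m > 0 \<and> poly E0 0 = e0 \<and> poly E1 0 = 0 \<and> poly E2 0 = 0 \<and>
           (\<forall>s. poly E0 s * poly E1 s * poly E2 s = poly G (t0 + s ^ m))"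
proof -
  \<comment> \<open>Split off the root: G(t0 + x) = x h(x). Substituting x = s^3 or x = s^2 then
    gives factors \<open>s\<close> to distribute over the vanishing coordinates.\<close>
  have "poly (pcompose G [:t0, 1:]) 0 = 0" using assms by (simp add: poly_pcompose)
  then obtain h where "pcompose G [:t0, 1:] = [:0, 1:] * h"
    by (metis dvdE minus_zero poly_eq_0_iff_dvd)
  hence "poly (pcompose G [:t0, 1:]) x = x * poly h x" for x
    by simp
  hence h: "poly G (t0 + x) = x * poly h x" for x
    by (simp add: poly_pcompose)
  show ?thesis
  proof (cases "e0 = 0")
    case True
    show ?thesis
      by (rule exI[of _ 3], rule exI[of _ "[:0, 1:]"], rule exI[of _ "[:0, 1:]"],
          rule exI[of _ "[:0, 1:] * pcompose h (monom 1 3)"])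
         (simp add: True h poly_pcompose poly_monom power3_eq_cube)
  next
    case False
    show ?thesis
      by (rule exI[of _ 2], rule exI[of _ "[:e0:]"], rule exI[of _ "[:0, 1:]"],
          rule exI[of _ "[:0, 1 / e0:] * pcompose h (monom 1 2)"])
         (simp add: False h poly_pcompose poly_monom power2_eq_square)
  qed
qed

text \<open>The exponent \<open>m\<close> is the number of vanishing coordinates (but at least 1), so that a zero of
  \<open>G\<close> at \<open>t0\<close> leaves one factor \<open>s\<close> for each of them.\<close>

lemma product_curve:
  fixes G :: "'b::field poly"
  assumes G: "poly G t0 = e0 * e1 * e2"
  obtains m E0 E1 E2 where "m > 0" "poly E0 0 = e0" "poly E1 0 = e1" "poly E2 0 = e2"
    "\<And>s. poly E0 s * poly E1 s * poly E2 s = poly G (t0 + s ^ m)"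
proof -
  \<comment> \<open>Among three coordinates two are nonzero or two vanish; in the latter case
    \<open>G\<close> vanishes at \<open>t0\<close>.\<close>
  consider "e0 \<noteq> 0" "e1 \<noteq> 0" | "e0 \<noteq> 0" "e2 \<noteq> 0" | "e1 \<noteq> 0" "e2 \<noteq> 0"
    | "e1 = 0" "e2 = 0" | "e0 = 0" "e2 = 0" | "e0 = 0" "e1 = 0" by blast
  thus ?thesis
  proof cases
    case 1
    obtain m F0 F1 F2 where "m > 0" "poly F0 0 = e0" "poly F1 0 = e1" "poly F2 0 = e2"
        "\<And>s. poly F0 s * poly F1 s * poly F2 s = poly G (t0 + s ^ m)"
      using product_curve_nonzero[of G t0 e0 e1 e2] 1 G by (auto simp: mult_ac)
    thus ?thesis using 1 by (intro that[of m F0 F1 F2]) (simp_all add: mult_ac)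
  next
    case 2
    obtain m F0 F1 F2 where "m > 0" "poly F0 0 = e0" "poly F1 0 = e2" "poly F2 0 = e1"
        "\<And>s. poly F0 s * poly F1 s * poly F2 s = poly G (t0 + s ^ m)"
      using product_curve_nonzero[of G t0 e0 e2 e1] 2 G by (auto simp: mult_ac)
    thus ?thesis using 2 by (intro that[of m F0 F2 F1]) (simp_all add: mult_ac)
  next
    case 3
    obtain m F0 F1 F2 where "m > 0" "poly F0 0 = e1" "poly F1 0 = e2" "poly F2 0 = e0"
        "\<And>s. poly F0 s * poly F1 s * poly F2 s = poly G (t0 + s ^ m)"
      using product_curve_nonzero[of G t0 e1 e2 e0] 3 G by (auto simp: mult_ac)
    thus ?thesis using 3 by (intro that[of m F2 F0 F1]) (simp_all add: mult_ac)
  next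
    case 4
    obtain m F0 F1 F2 where "m > 0" "poly F0 0 = e0" "poly F1 0 = 0" "poly F2 0 = 0"
        "\<And>s. poly F0 s * poly F1 s * poly F2 s = poly G (t0 + s ^ m)"
      using product_curve_zero[of G t0 e0] 4 G by (auto simp: mult_ac)
    thus ?thesis using 4 by (intro that[of m F0 F1 F2]) (simp_all add: mult_ac)
  next
    case 5
    obtain m F0 F1 F2 where "m > 0" "poly F0 0 = e1" "poly F1 0 = 0" "poly F2 0 = 0"
        "\<And>s. poly F0 s * poly F1 s * poly F2 s = poly G (t0 + s ^ m)"
      using product_curve_zero[of G t0 e1] 5 G by (auto simp: mult_ac)
    thus ?thesis using 5 by (intro that[of m F1 F0 F2]) (simp_all add: mult_ac)
  next
    case 6
    obtain m F0 F1 F2 where "m > 0" "poly F0 0 = e2" "poly F1 0 = 0" "poly F2 0 = 0"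
        "\<And>s. poly F0 s * poly F1 s * poly F2 s = poly G (t0 + s ^ m)"
      using product_curve_zero[of G t0 e2] 6 G by (auto simp: mult_ac)
    thus ?thesis using 6 by (intro that[of m F1 F2 F0]) (simp_all add: mult_ac)
  qed
qed

text \<open>In conjugate coordinates the norm is a product, so \<open>product_curve\<close> applies
  and the linear map \<open>uneval3\<close> carries its curve back. Even a singular point is thus
  joined to neighbouring fibres.\<close>

lemma norm3_curve:
  fixes b :: "'b::{alg_closed_field, field_char_0}"
  assumes "b \<noteq> 0" "norm3 b (x, y, z) = poly G t0"
  obtains m A B Z where "m > 0" "poly A 0 = x" "poly B 0 = y" "poly Z 0 = z"
    "\<And>s. norm3 b (poly A s, poly B s, poly Z s) = poly G (t0 + s ^ m)"
proof -
  obtain \<alpha> \<omega> where "split_cubic b \<alpha> \<omega>" using split_cubic_exists assms(1) by blast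
  then interpret split_cubic b \<alpha> \<omega> .
  obtain m E0 E1 E2 where m: "m > 0" and E: "poly E0 0 = eval3 \<alpha> (x, y, z)"
      "poly E1 0 = eval3 (\<omega> * \<alpha>) (x, y, z)" "poly E2 0 = eval3 (\<omega> ^ 2 * \<alpha>) (x, y, z)"
    and G: "\<And>s. poly E0 s * poly E1 s * poly E2 s = poly G (t0 + s ^ m)"
    using product_curve[OF assms(2)[symmetric, unfolded norm3_eq]] by blast
  define A where "A = smult (1 / 3) (E0 + E1 + E2)"
  define B where "B = smult (1 / (3 * \<alpha>)) (E0 - smult (\<omega> + 1) E1 + smult \<omega> E2)"
  define Z where "Z = smult (1 / (3 * \<alpha> ^ 2)) (E0 + smult \<omega> E1 - smult (\<omega> + 1) E2)"
  have XYZ: "(poly A s, poly B s, poly Z s) = uneval3 (poly E0 s) (poly E1 s) (poly E2 s)" for s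
    by (simp add: A_def B_def Z_def uneval3_def)
  show ?thesis
  proof (rule that[OF m])
    have "(poly A 0, poly B 0, poly Z 0) = (x, y, z)"
      unfolding XYZ E by (rule uneval3_eval3)
    thus "poly A 0 = x" "poly B 0 = y" "poly Z 0 = z" by auto
    show "norm3 b (poly A s, poly B s, poly Z s) = poly G (t0 + s ^ m)" for s
      unfolding XYZ norm3_uneval3 G ..
  qed
qed

section \<open>Density from infinitely many full fibres\<close>

lemma norm_variety_eq:
  "norm_variety b g = {x \<in> affine_space 4.
     norm3 (to_ac b) (x 0, x 1, x 2) = poly (map_poly to_ac g) (x 3)}"
  by (simp add: norm_variety_def norm3_def)

text \<open>Through every point runs a polynomial curve inside the variety on which \<open>t\<close>
  is nonconstant. It meets infinitely many of the fibres over \<open>S\<close>, so \<open>Z\<close>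
  contains all of it. This takes the place of an argument by irreducibility and dimension.\<close>

lemma norm_variety_closure:
  fixes b :: "'a::field_char_0"
  assumes Z: "zariski_closed 4 Z" and b: "b \<noteq> 0" and S: "infinite S"
    and sub: "\<And>x. x \<in> norm_variety b g \<Longrightarrow> x 3 \<in> S \<Longrightarrow> x \<in> Z"
  shows "norm_variety b g \<subseteq> Z"
proof
  fix x assume x: "x \<in> norm_variety b g"
  let ?G = "map_poly to_ac g"
  have eq: "norm3 (to_ac b) (x 0, x 1, x 2) = poly ?G (x 3)"
    using x by (simp add: norm_variety_eq)
  have "to_ac b \<noteq> 0" using b by simp
  then obtain m X0 X1 X2 where m: "m > 0" and X0: "poly X0 0 = x 0" "poly X1 0 = x 1" "poly X2 0 = x 2"
    and G: "\<And>s. norm3 (to_ac b) (poly X0 s, poly X1 s, poly X2 s) = poly ?G (x 3 + s ^ m)"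
    using norm3_curve[OF _ eq] by blast
  define C where "C = (\<lambda>i::nat. [X0, X1, X2, [:x 3:] + monom 1 m] ! i)"
  define c where "c s = (\<lambda>i\<in>{..<4}. poly (C i) s)" for s
  have c: "c s 0 = poly X0 s" "c s 1 = poly X1 s" "c s 2 = poly X2 s" "c s 3 = x 3 + s ^ m" for s
    by (auto simp: c_def C_def poly_monom)
  have "c s \<in> affine_space 4" for s
    by (auto simp: c_def affine_space_def)
  hence cV: "c s \<in> norm_variety b g" for s
    unfolding norm_variety_eq by (simp only: mem_Collect_eq c G simp_thms)
  have "S \<subseteq> (\<lambda>s. x 3 + s ^ m) ` {s. c s \<in> Z}"
  proof
    fix t assume "t \<in> S"
    \<comment> \<open>Every value of \<open>t\<close> is attained on the curve, so finitely many
      \<open>s\<close> could not cover the infinite set \<open>S\<close>.\<close>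
    obtain s where "s ^ m = t - x 3" using nth_root_exists[OF m] by blast
    hence "t = x 3 + s ^ m" by simp
    thus "t \<in> (\<lambda>s. x 3 + s ^ m) ` {s. c s \<in> Z}"
      using \<open>t \<in> S\<close> sub[OF cV[of s]] by (auto simp: c)
  qed
  hence "infinite {s. c s \<in> Z}" using S finite_surj by blast
  hence "c 0 \<in> Z" unfolding c_def by (rule in_zariski_closed_curve[OF Z])
  moreover have "c 0 i = x i" for i
  proof (cases "i < 4")
    case True
    hence "i = 0 \<or> i = 1 \<or> i = 2 \<or> i = 3" by auto
    thus ?thesis using m X0 c[of 0] by auto
  next
    case False
    thus ?thesis using x by (auto simp: c_def norm_variety_def affine_space_def PiE_def extensional_def)
  qed
  ultimately show "x \<in> Z" by (simp add: ext[of "c 0" x])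
qed

subsection \<open>The multisection\<close>

text \<open>The coefficient of T^5 that is left over in the difference of both sides, multiplied by
  \<open>(C - 2 * w) ^ 2\<close>.\<close>

definition num_fun :: "'b::comm_ring_1 \<Rightarrow> 'b \<Rightarrow> 'b \<Rightarrow> 'b \<Rightarrow> 'b \<Rightarrow> 'b \<Rightarrow> 'b" where
  "num_fun p P C D E w = E * (C - 2 * w) ^ 2 - 3 * w * (D - p * w) ^ 2
     + p * (D - p * w) * (C + w) * (C - 2 * w) + P * (C + w) * (C - 2 * w) ^ 2"

text \<open>The remaining coefficient of T^6, multiplied by
  \<open>27 * w * (C - 2 * w) ^ 3\<close>.\<close>

definition den_fun :: "'b::comm_ring_1 \<Rightarrow> 'b \<Rightarrow> 'b \<Rightarrow> 'b \<Rightarrow> 'b \<Rightarrow> 'b \<Rightarrow> 'b" where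
  "den_fun p P C D F w = 27 * F * w * (C - 2 * w) ^ 3 - 27 * w ^ 2 * (D - p * w) ^ 3
     + (C + w) ^ 3 * (C - 2 * w) ^ 3 + 27 * P * w * (D - p * w) * (C + w) * (C - 2 * w) ^ 2"

text \<open>Comparing the coefficients of \<open>T\<close>, \<open>T\<^sup>2\<close>, \<open>T\<^sup>3\<close>, \<open>T\<^sup>4\<close> determines \<open>p\<close>, \<open>P\<close>, \<open>r\<close>, \<open>q\<close> successively. \<open>C\<close>, \<open>D\<close>,
  \<open>E\<close>, \<open>F\<close> are what \<open>p\<close> and \<open>P\<close> leave of the coefficients of \<open>T\<^sup>3\<close>, ..., \<open>T\<^sup>6\<close> of the right-hand side, up to
  sign, and \<open>T\<close> depends on \<open>u\<close> only through \<open>w = b u\<^sup>3\<close>.\<close>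

lemma norm3_multisection:
  fixes b u p P C D E F :: "'b::field_char_0"
  defines "w \<equiv> b * u ^ 3"
  defines "d \<equiv> C - 2 * w"
  defines "T \<equiv> - (27 * w * d * num_fun p P C D E w / den_fun p P C D F w)"
  assumes nz: "b \<noteq> 0" "u \<noteq> 0" "d \<noteq> 0" "den_fun p P C D F w \<noteq> 0"
  shows "norm3 b (1 + p * T + P * T ^ 2, u * T + u * (D - p * w) / d * T ^ 2, (C + w) / (3 * b * u) * T ^ 2)
    = 1 + 3 * p * T + (3 * P + 3 * p ^ 2) * T ^ 2 + (C + p ^ 3 + 6 * p * P) * T ^ 3
      + (D + 3 * p ^ 2 * P + 3 * P ^ 2 + p * C) * T ^ 4 + (3 * p * P ^ 2 - E) * T ^ 5 + (P ^ 3 - F) * T ^ 6"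
proof -
  define Q where "Q = (D - p * w) / d"
  define q where "q = u * Q"
  define r where "r = (C + w) / (3 * b * u)"
  have w: "w \<noteq> 0" using nz by (simp add: w_def)
  have Q: "Q * d = D - p * w" using nz by (simp add: Q_def)
  have r: "3 * (b * u * r) = C + w" using nz by (simp add: r_def)
  have qr: "3 * (b * q * r) = Q * (C + w)" using r unfolding q_def by Groebner_Basis.algebra
  have r3: "27 * w * (b ^ 2 * r ^ 3) = (C + w) ^ 3"
    using r unfolding w_def by Groebner_Basis.algebra
  define A5 where "A5 = E - 3 * w * Q ^ 2 + p * Q * (C + w) + P * (C + w)"
  define A6 where "A6 = F - w * Q ^ 3 + b ^ 2 * r ^ 3 + P * Q * (C + w)"
  have A5: "num_fun p P C D E w = A5 * d ^ 2"
    unfolding num_fun_def A5_def d_def[symmetric] Q[symmetric] by Groebner_Basis.algebra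
  have A6: "den_fun p P C D F w = A6 * (27 * w * d ^ 3)"
    using r3 unfolding den_fun_def A6_def d_def[symmetric] Q[symmetric] by Groebner_Basis.algebra
  have "A6 \<noteq> 0" using A6 nz by auto
  have "T = - (A5 * (27 * w * d ^ 3) / (A6 * (27 * w * d ^ 3)))"
    by (simp add: T_def A5 A6 power2_eq_square power3_eq_cube mult_ac)
  hence "T = - (A5 / A6)" using w nz by simp
  hence T: "A5 + A6 * T = 0" using \<open>A6 \<noteq> 0\<close> by simp
  \<comment> \<open>\<open>e3\<close> and \<open>e4\<close> match the coefficients of T^3 and T^4.
    The latter is linear in \<open>Q\<close> with factor \<open>(C + w) - 3 * w = d\<close>, whence
    the denominator \<open>d\<close>.\<close>
  have e3: "3 * (b * u * r) - w = C" using r by simp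
  have e4: "Q * (C + w) - 3 * w * Q = D - p * w" using Q unfolding d_def by Groebner_Basis.algebra
  have wQ: "b * u ^ 2 * q = w * Q" "b * u * q ^ 2 = w * Q ^ 2" "b * q ^ 3 = w * Q ^ 3" "b * u ^ 3 = w"
    unfolding q_def w_def by (simp_all add: power2_eq_square power3_eq_cube mult_ac)
  have "norm3 b (1 + p * T + P * T ^ 2, u * T + q * T ^ 2, r * T ^ 2) =
      1 + 3 * p * T + (3 * P + 3 * p ^ 2) * T ^ 2
      + (p ^ 3 + 6 * p * P - b * u ^ 3 + 3 * (b * u * r)) * T ^ 3
      + (3 * p ^ 2 * P + 3 * P ^ 2 - 3 * (b * u ^ 2 * q) + 3 * (b * u * r) * p + 3 * (b * q * r)) * T ^ 4
      + (3 * p * P ^ 2 - 3 * (b * u * q ^ 2) + p * (3 * (b * q * r)) + P * (3 * (b * u * r))) * T ^ 5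
      + (P ^ 3 - b * q ^ 3 + b ^ 2 * r ^ 3 + P * (3 * (b * q * r))) * T ^ 6"
    unfolding norm3_def prod.case by Groebner_Basis.algebra
  also have "\<dots>
    = 1 + 3 * p * T + (3 * P + 3 * p ^ 2) * T ^ 2 + (C + p ^ 3 + 6 * p * P) * T ^ 3
      + (D + 3 * p ^ 2 * P + 3 * P ^ 2 + p * C) * T ^ 4 + (3 * p * P ^ 2 - E) * T ^ 5 + (P ^ 3 - F) * T ^ 6
      + T ^ 5 * (A5 + A6 * T)"
    unfolding wQ qr r A5_def A6_def using e4 by Groebner_Basis.algebra
  finally show ?thesis unfolding T by (simp add: q_def r_def Q_def)
qed

section \<open>Nonconstancy of \<open>T\<close>\<close>

lemma infinite_cofinite_image:
  fixes M N :: "'b::{field_char_0} poly"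
  assumes indep: "\<And>c. M \<noteq> smult c N" and "R \<noteq> 0" and "N \<noteq> 0"
  shows "infinite ((\<lambda>w. poly M w / poly N w) ` {w. poly R w \<noteq> 0 \<and> poly N w \<noteq> 0})"
proof
  let ?S = "{w. poly R w \<noteq> 0 \<and> poly N w \<noteq> 0}"
  assume fin: "finite ((\<lambda>w. poly M w / poly N w) ` ?S)"
  have "finite {w. poly (R * N) w = 0}" using assms by (intro poly_roots_finite) auto
  moreover have "UNIV = {w. poly (R * N) w = 0} \<union> ?S" by auto
  ultimately have "infinite ?S" using infinite_UNIV_char_0 by (metis finite_Un)
  \<comment> \<open>With finitely many values some value c is taken infinitely often, and then M - c
    N has too many roots.\<close>
  then obtain w0 where "infinite {w \<in> ?S. poly M w / poly N w = poly M w0 / poly N w0}"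
    using pigeonhole_infinite[OF _ fin] by blast
  moreover define c where "c = poly M w0 / poly N w0"
  have "{w \<in> ?S. poly M w / poly N w = c} \<subseteq> {w. poly (M - smult c N) w = 0}"
    by (auto simp: field_simps)
  ultimately have "infinite {w. poly (M - smult c N) w = 0}"
    unfolding c_def using finite_subset by blast
  hence "M - smult c N = 0" using poly_roots_finite by blast
  thus False using indep[of c] by simp
qed

text \<open>In \<open>w\<close> the numerator has degree at most 5 and the denominator degree 6, so
  a constant quotient would force the numerator to vanish identically. The assumption excludes
  exactly what that vanishing would imply.\<close>

lemma infinite_parameter_values:
  fixes p P C D E F :: "'b::field_char_0"
  assumes "\<not> (4 * P = p ^ 2 \<and> 2 * D = p * C \<and> 4 * E = - 3 * p ^ 2 * C)"
  shows "infinite ((\<lambda>w. - (27 * w * (C - 2 * w) * num_fun p P C D E w / den_fun p P C D F w)) `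
           {w. w \<noteq> 0 \<and> C - 2 * w \<noteq> 0 \<and> den_fun p P C D F w \<noteq> 0})"
proof -
  define a0 where "a0 = C ^ 2 * (E + p * D + P * C)"
  define a1 where "a1 = - 4 * E * C - 3 * D ^ 2 - p * D * C - p ^ 2 * C ^ 2 - 3 * P * C ^ 2"
  define a2 where "a2 = 4 * E + 4 * p * D + p ^ 2 * C"
  define a3 where "a3 = 4 * P - p ^ 2"
  define M where "M = [:0, - 27:] * [:C, - 2:] * [:a0, a1, a2, a3:]"
  define N where "N = [:0, 27 * F:] * [:C, - 2:] ^ 3 - [:0, 0, 27:] * [:D, - p:] ^ 3
    + [:C, 1:] ^ 3 * [:C, - 2:] ^ 3 + [:0, 27 * P:] * [:D, - p:] * [:C, 1:] * [:C, - 2:] ^ 2"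
  have "num_fun p P C D E w = poly [:a0, a1, a2, a3:] w" for w
    by (simp add: num_fun_def a0_def a1_def a2_def a3_def power2_eq_square algebra_simps)
  hence M: "poly M w = - (27 * w * (C - 2 * w) * num_fun p P C D E w)" for w
    by (simp add: M_def algebra_simps)
  have N: "poly N w = den_fun p P C D F w" for w
    by (simp add: N_def den_fun_def power2_eq_square algebra_simps)
  have "[:a0, a1, a2, a3:] \<noteq> 0"
  proof
    assume "[:a0, a1, a2, a3:] = 0"
    hence a: "a1 = 0" "a2 = 0" "a3 = 0" by auto
    \<comment> \<open>Eliminating \<open>E\<close> by \<open>a2\<close> and \<open>P\<close> by
      \<open>a3\<close> turns \<open>a1\<close> into -3/4 times this square.\<close>
    have "3 * (2 * D - p * C) ^ 2 = 0"
      using a unfolding a1_def a2_def a3_def by Groebner_Basis.algebra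
    hence D: "2 * D = p * C" by simp
    moreover have "4 * P = p ^ 2" using a(3) by (simp add: a3_def)
    moreover have "4 * E = - 3 * p ^ 2 * C" using a(2) D unfolding a2_def by Groebner_Basis.algebra
    ultimately show False using assms by blast
  qed
  hence "M \<noteq> 0" unfolding M_def by (simp only: mult_eq_0_iff) auto
  have M6: "coeff M 6 = 0"
    by (simp add: M_def coeff_pCons eval_nat_numeral)
  have N6: "coeff N 6 = - 8"
    by (simp add: N_def power2_eq_square power3_eq_cube coeff_pCons eval_nat_numeral)
  have "M \<noteq> smult c N" for c
    using M6 N6 \<open>M \<noteq> 0\<close> by auto
  moreover have "N \<noteq> 0" using N6 by auto
  ultimately have "infinite ((\<lambda>w. poly M w / poly N w) ` {w. poly [:0, C, - 2:] w \<noteq> 0 \<and> poly N w \<noteq> 0})"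
    by (intro infinite_cofinite_image) auto
  thus ?thesis by (simp add: M N conj_assoc mult.commute)
qed

section \<open>The dominant rational map\<close>

lemma polyfun_num_fun [polyfun_intros]:
  "polyfun n f \<Longrightarrow> polyfun n (\<lambda>x. num_fun (to_ac p) (to_ac P) (to_ac C) (to_ac D) (to_ac E) (f x))"
  unfolding num_fun_def by (intro polyfun_intros)

lemma polyfun_den_fun [polyfun_intros]:
  "polyfun n f \<Longrightarrow> polyfun n (\<lambda>x. den_fun (to_ac p) (to_ac P) (to_ac C) (to_ac D) (to_ac F) (f x))"
  unfolding den_fun_def by (intro polyfun_intros)

lemma unirational_multisection:
  fixes b p P C D E F :: "'a::field_char_0"
  assumes b: "b \<noteq> 0"
    and nondeg: "\<not> (4 * P = p ^ 2 \<and> 2 * D = p * C \<and> 4 * E = - 3 * p ^ 2 * C)"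
    and g: "g = [:1, 3 * p, 3 * P + 3 * p ^ 2, C + p ^ 3 + 6 * p * P,
      D + 3 * p ^ 2 * P + 3 * P ^ 2 + p * C, 3 * p * P ^ 2 - E, P ^ 3 - F:]"
  shows "k_unirational 4 (norm_variety b g)"
proof -
  let ?b = "to_ac b" and ?p = "to_ac p" and ?P = "to_ac P" and ?C = "to_ac C" and ?D = "to_ac D"
    and ?E = "to_ac E" and ?F = "to_ac F" and ?G = "map_poly to_ac g"
  define w where "w u = ?b * u ^ 3" for u
  define d where "d u = ?C - 2 * w u" for u
  define M where "M u = - (27 * w u * d u * num_fun ?p ?P ?C ?D ?E (w u))" for u
  define N where "N u = den_fun ?p ?P ?C ?D ?F (w u)" for u
  \<comment> \<open>A common denominator of the coordinates of the multisection point
    \<open>A u\<close>; \<open>A' u\<close> is that point with the denominators cleared.\<close>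
  define k where "k u = 3 * ?b * u * d u * N u ^ 2" for u
  define T where "T u = M u / N u" for u
  define A where "A u = (1 + ?p * T u + ?P * T u ^ 2, u * T u + u * (?D - ?p * w u) / d u * T u ^ 2,
    (?C + w u) / (3 * ?b * u) * T u ^ 2)" for u
  define A' where "A' u = (3 * ?b * u * d u * (N u ^ 2 + ?p * M u * N u + ?P * M u ^ 2),
    3 * ?b * u * d u * (u * M u * N u) + 3 * ?b * u * (u * (?D - ?p * w u)) * M u ^ 2,
    d u * (?C + w u) * M u ^ 2)" for u
  have b': "?b \<noteq> 0" using b by simp
  have k: "k u \<noteq> 0 \<longleftrightarrow> u \<noteq> 0 \<and> d u \<noteq> 0 \<and> N u \<noteq> 0" for u
    using b' by (auto simp: k_def)
  have A': "A' u = scale3 (k u) (A u)" if "k u \<noteq> 0" for u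
    using that b' unfolding k A'_def A_def scale3_def k_def T_def
    by (simp add: field_simps power2_eq_square)
  have G: "poly ?G t = 1 + 3 * ?p * t + (3 * ?P + 3 * ?p ^ 2) * t ^ 2 + (?C + ?p ^ 3 + 6 * ?p * ?P) * t ^ 3
      + (?D + 3 * ?p ^ 2 * ?P + 3 * ?P ^ 2 + ?p * ?C) * t ^ 4 + (3 * ?p * ?P ^ 2 - ?E) * t ^ 5
      + (?P ^ 3 - ?F) * t ^ 6" for t
    unfolding g by (simp add: map_poly_pCons eval_nat_numeral algebra_simps)
  have A: "norm3 ?b (A u) = poly ?G (T u)" if "k u \<noteq> 0" for u
    using norm3_multisection[of ?b u ?C ?p ?P ?D ?F ?E] that b'
    unfolding k A_def G T_def M_def N_def d_def w_def by simp

  \<comment> \<open>The source is 4-space with coordinates u = \<open>v 0\<close> and W =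
    \<open>(v 1, v 2, v 3)\<close>. The map sends them to A(u) W^3 / N(W) in the fibre over T(u),
    and the factor W^3 / N(W) has norm one.\<close>
  define h where "h v = k (v 0) * norm3 ?b (v 1, v 2, v 3)" for v :: "nat \<Rightarrow> 'a alg_closure"
  define R where "R v = mult3 ?b (A' (v 0)) (cube3 ?b (v 1, v 2, v 3))" for v :: "nat \<Rightarrow> 'a alg_closure"
  define f where "f i v = [fst (R v), fst (snd (R v)), snd (snd (R v)),
    3 * ?b * v 0 * d (v 0) * (M (v 0) * N (v 0)) * norm3 ?b (v 1, v 2, v 3)] ! i"
    for i and v :: "nat \<Rightarrow> 'a alg_closure"
  define out where "out v = (\<lambda>i\<in>{..<4::nat}. f i v / h v)" for v
  have poly_R: "polyfun 4 (\<lambda>v. fst (R v))" "polyfun 4 (\<lambda>v. fst (snd (R v)))" "polyfun 4 (\<lambda>v. snd (snd (R v)))"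
    "polyfun 4 (\<lambda>v. 3 * ?b * v 0 * d (v 0) * (M (v 0) * N (v 0)) * norm3 ?b (v 1, v 2, v 3))"
    and h_poly: "polyfun 4 h"
    unfolding R_def h_def k_def A'_def cube3_def mult3_def norm3_def prod.case fst_conv snd_conv
      M_def N_def d_def w_def
    by (intro polyfun_intros; simp)+
  have f_poly: "polyfun 4 (f i)" if "i < 4" for i
  proof -
    have "i = 0 \<or> i = 1 \<or> i = 2 \<or> i = 3" using that by auto
    thus ?thesis using poly_R by (auto simp: f_def[abs_def])
  qed
  have out: "(out v 0, out v 1, out v 2) = scale3 (1 / norm3 ?b (v 1, v 2, v 3))
      (mult3 ?b (A (v 0)) (cube3 ?b (v 1, v 2, v 3)))" "out v 3 = T (v 0)"
    if "h v \<noteq> 0" for v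
  proof -
    have kv: "k (v 0) \<noteq> 0" using that by (auto simp: h_def)
    have "(out v 0, out v 1, out v 2) = scale3 (1 / h v) (R v)"
      by (cases "R v") (simp add: out_def f_def scale3_def)
    thus "(out v 0, out v 1, out v 2) = scale3 (1 / norm3 ?b (v 1, v 2, v 3))
      (mult3 ?b (A (v 0)) (cube3 ?b (v 1, v 2, v 3)))"
      using kv that by (simp add: R_def A' mult3_scale scale3_scale h_def)
    show "out v 3 = T (v 0)"
      using that kv b' unfolding k by (simp add: out_def f_def h_def k_def T_def power2_eq_square)
  qed

  let ?Dom = "{x \<in> affine_space 4. h x \<noteq> 0}"
  have sub: "out ` ?Dom \<subseteq> norm_variety b g"
  proof safe
    fix v assume v: "h v \<noteq> 0"
    hence "k (v 0) \<noteq> 0" "norm3 ?b (v 1, v 2, v 3) \<noteq> 0" by (auto simp: h_def)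
    hence "norm3 ?b (out v 0, out v 1, out v 2) = poly ?G (out v 3)"
      unfolding out[OF v] norm3_scale norm3_mult norm3_cube A[OF \<open>k (v 0) \<noteq> 0\<close>]
      by (simp add: power_divide)
    moreover have "out v \<in> affine_space 4" by (auto simp: out_def affine_space_def)
    ultimately show "out v \<in> norm_variety b g" by (simp only: norm_variety_eq mem_Collect_eq simp_thms)
  qed

  have "\<not> (4 * ?P = ?p ^ 2 \<and> 2 * ?D = ?p * ?C \<and> 4 * ?E = - 3 * ?p ^ 2 * ?C)"
  proof
    assume "4 * ?P = ?p ^ 2 \<and> 2 * ?D = ?p * ?C \<and> 4 * ?E = - 3 * ?p ^ 2 * ?C"
    hence "to_ac (4 * P) = to_ac (p ^ 2)" "to_ac (2 * D) = to_ac (p * C)"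
      "to_ac (4 * E) = to_ac (- 3 * p ^ 2 * C)" by simp_all
    thus False using nondeg unfolding to_ac_eq_iff by blast
  qed
  note inf = infinite_parameter_values[OF this, of ?F]
  have "(\<lambda>w. - (27 * w * (?C - 2 * w) * num_fun ?p ?P ?C ?D ?E w / den_fun ?p ?P ?C ?D ?F w)) `
           {w. w \<noteq> 0 \<and> ?C - 2 * w \<noteq> 0 \<and> den_fun ?p ?P ?C ?D ?F w \<noteq> 0} \<subseteq> T ` {u. k u \<noteq> 0}"
  proof safe
    fix x assume x: "x \<noteq> 0" "?C - 2 * x \<noteq> 0" "den_fun ?p ?P ?C ?D ?F x \<noteq> 0"
    \<comment> \<open>Over the algebraic closure each value of \<open>w\<close> comes from some
      \<open>u\<close>, so passing from \<open>w\<close> to \<open>u\<close> loses no value of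
      \<open>T\<close>.\<close>
    obtain u where "u ^ 3 = x / ?b" using nth_root_exists[of 3] by auto
    hence u: "w u = x" using b' by (simp add: w_def)
    moreover have "u \<noteq> 0" using x(1) u by (auto simp: w_def)
    ultimately have "k u \<noteq> 0" using x unfolding k by (simp add: d_def N_def)
    moreover have "- (27 * x * (?C - 2 * x) * num_fun ?p ?P ?C ?D ?E x / den_fun ?p ?P ?C ?D ?F x) = T u"
      by (simp add: T_def M_def N_def d_def u)
    ultimately show "- (27 * x * (?C - 2 * x) * num_fun ?p ?P ?C ?D ?E x / den_fun ?p ?P ?C ?D ?F x)
        \<in> T ` {u. k u \<noteq> 0}" by auto
  qed
  hence infT: "infinite (T ` {u. k u \<noteq> 0})" using inf finite_subset by blast
  \<comment> \<open>\<open>norm3_fibre\<close> needs a nonzero norm, so the roots of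
    \<open>g\<close> are discarded. They are finitely many because g(0) = 1.\<close>
  have "poly ?G 0 \<noteq> 0" by (simp add: G)
  hence "finite {t. poly ?G t = 0}" by (intro poly_roots_finite) auto
  hence infS: "infinite (T ` {u. k u \<noteq> 0} - {t. poly ?G t = 0})"
    using infT by (rule Diff_infinite_finite)

  have hit: "x \<in> out ` ?Dom"
    if x: "x \<in> norm_variety b g" and S: "x 3 \<in> T ` {u. k u \<noteq> 0} - {t. poly ?G t = 0}" for x
  proof -
    obtain u where u: "k u \<noteq> 0" "x 3 = T u" and G0: "poly ?G (x 3) \<noteq> 0" using S by auto
    have "norm3 ?b (A u) = norm3 ?b (x 0, x 1, x 2)" "norm3 ?b (A u) \<noteq> 0"
      using x A[OF u(1)] G0 by (simp_all add: norm_variety_eq u(2))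
    then obtain W where W: "norm3 ?b W = 1" "mult3 ?b (A u) (cube3 ?b W) = (x 0, x 1, x 2)"
      using norm3_fibre[OF b'] by blast
    obtain r s t where W_eq: "W = (r, s, t)" by (cases W)
    define v where "v = (\<lambda>i\<in>{..<4}. [u, r, s, t] ! i)"
    have v: "v 0 = u" "(v 1, v 2, v 3) = W" by (simp_all add: v_def W_eq)
    have "v \<in> affine_space 4" by (auto simp: v_def affine_space_def)
    moreover have hv: "h v \<noteq> 0" unfolding h_def v W(1) using u by simp
    moreover have "out v = x"
    proof
      fix i :: nat
      have "(out v 0, out v 1, out v 2) = (x 0, x 1, x 2)" "out v 3 = x 3"
        unfolding out[OF hv] v W u by (simp_all add: scale3_def)
      moreover have "i \<in> {0, 1, 2, 3} \<or> i \<ge> 4" by auto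
      \<comment> \<open>Points of affine space are extensional: beyond index 3 both sides are
        \<open>undefined\<close>.\<close>
      moreover have "out v i = x i" if "i \<ge> 4"
        using that x by (auto simp: out_def norm_variety_def affine_space_def PiE_def extensional_def)
      ultimately show "out v i = x i" by auto
    qed
    ultimately show ?thesis by blast
  qed

  obtain u where u: "k u \<noteq> 0" using infT by (metis (mono_tags, lifting) Collect_empty_eq finite.emptyI image_empty)
  \<comment> \<open>The element W = 1 has norm one, so \<open>h\<close> is nonzero here and the
    denominator is not the zero polynomial.\<close>
  define v where "v = (\<lambda>i::nat. [u, 1, 0, 0] ! i)"
  have "(v 1, v 2, v 3) = (1, 0, 0)" "v 0 = u" by (simp_all add: v_def)
  hence "h v \<noteq> 0" unfolding h_def using u by (simp add: norm3_def)
  moreover have "zariski_dense_in 4 (out ` ?Dom) (norm_variety b g)"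
    unfolding zariski_dense_in_def using sub norm_variety_closure[OF _ b infS] hit by blast
  ultimately show ?thesis
    using k_unirationalI[OF f_poly h_poly] unfolding out_def by simp
qed

theorem theorem2p1:
  fixes b :: "'a::field_char_0"
    and \<alpha> :: "'a alg_closure"
    and K :: "'a alg_closure set"
    and c :: "nat \<Rightarrow> 'a"
    and g :: "'a poly"
  assumes b_not_cube: "\<nexists>y. b = y ^ 3"
    and alpha: "\<alpha> ^ 3 + to_ac b = 0"
    and K: "K = field_adjoin \<alpha>"
    and g: "g = 1 + (\<Sum>i = 1..6. Polynomial.monom (c i) i)"
    and c: "(c 2, c 4, c 5) \<noteq>
      (5 * c 1 ^ 2 / 12,
       - (1 / 144) * c 1 * (5 * c 1 ^ 3 - 72 * c 3),
       - (1 / 144) * c 1 ^ 2 * (c 1 ^ 3 - 12 * c 3))"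
  shows "k_unirational 4 (norm_variety b g)"
proof -
  \<comment> \<open>These values solve successively, from the coefficient of t upwards, the
    expression for \<open>g\<close> in \<open>unirational_multisection\<close>.\<close>
  define p where "p = c 1 / 3"
  define P where "P = c 2 / 3 - p ^ 2"
  define C where "C = c 3 - p ^ 3 - 6 * p * P"
  define D where "D = c 4 - 3 * p ^ 2 * P - 3 * P ^ 2 - p * C"
  define E where "E = 3 * p * P ^ 2 - c 5"
  define F where "F = P ^ 3 - c 6"
  have c1: "c 1 = 3 * p" by (simp add: p_def)
  have c2: "c 2 = 3 * P + 3 * p ^ 2" by (simp add: P_def)
  have c3: "c 3 = C + p ^ 3 + 6 * p * P" by (simp add: C_def)
  have c4: "c 4 = D + 3 * p ^ 2 * P + 3 * P ^ 2 + p * C" by (simp add: D_def)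
  have c5: "c 5 = 3 * p * P ^ 2 - E" by (simp add: E_def)
  have c6: "c 6 = P ^ 3 - F" by (simp add: F_def)
  have "b \<noteq> 0"
  proof
    assume "b = 0"
    hence "b = 0 ^ 3" by simp
    thus False using b_not_cube by blast
  qed
  moreover have "\<not> (4 * P = p ^ 2 \<and> 2 * D = p * C \<and> 4 * E = - 3 * p ^ 2 * C)"
  proof
    assume *: "4 * P = p ^ 2 \<and> 2 * D = p * C \<and> 4 * E = - 3 * p ^ 2 * C"
    \<comment> \<open>In the new parameters the degenerate case gives the excluded triple; 12 and
      144 clear its denominators.\<close>
    have "12 * c 2 = 5 * c 1 ^ 2"
      unfolding c1 c2 using * by Groebner_Basis.algebra
    moreover have "144 * c 4 = - (c 1 * (5 * c 1 ^ 3 - 72 * c 3))"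
      unfolding c1 c3 c4 using * by Groebner_Basis.algebra
    moreover have "144 * c 5 = - (c 1 ^ 2 * (c 1 ^ 3 - 12 * c 3))"
      unfolding c1 c3 c5 using * by Groebner_Basis.algebra
    ultimately show False using c by (simp add: field_simps)
  qed
  moreover have "g = [:1, c 1, c 2, c 3, c 4, c 5, c 6:]"
    unfolding g by (simp add: numeral_eq_Suc monom_Suc monom_0 one_pCons)
  ultimately show ?thesis
    using unirational_multisection[of b P p D C E g F] unfolding c1 c2 c3 c4 c5 c6 by blast
qed

end
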